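(* Let $X$ be a real Hilbert space, let $I=\{1,\dots,m\}$ with $m\ge 1$, and let $a_1,\dots,a_m\in X$. Suppose there is $z\in X$ with $\langle z,a_i\rangle>0$ for all $i\in I$. Let $C:=\{x\in X : \langle x,a_i\rangle\ge 0\text{ for all }i\in I\}$. Then for every real $\alpha>0$, every starting point $x_0\in X$ and every choice of violated indices, the generalized perceptron algorithm with constant step size $\alpha$ finds a point in $C$ after finitely many steps, i.e., there is $K\in\mathbb{N}$ such that the iterate $x_K$ is generated and $x_K\in C$.
   Context: $\mathbb{N}=\{0,1,2,\dots\}$. Generalized perceptron algorithm with constant step size $\alpha$: given $x_0\in X$, proceed as follows for $k=0,1,2,\dots$. If $x_k\in C$, stop. Otherwise, pick any index $i_k\in I$ with $\langle x_k,a_{i_k}\rangle<0$ and set $x_{k+1}:=x_k+\alpha a_{i_k}$. (This is the subgradient algorithm for the system $f_i(x)\le 0$, $i\in I$, with $f_i(x)=\langle x,-a_i\rangle$; the case $\alpha=1$ is the classical perceptron algorithm.) *)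

theory Defs
  imports "HOL-Analysis.Analysis"
begin

definition solution_cone :: "nat \<Rightarrow> (nat \<Rightarrow> 'a::real_inner) \<Rightarrow> 'a set" where
  "solution_cone m a = {x. \<forall>i\<in>{1..m}. x \<bullet> a i \<ge> 0}"

text \<open>
  A run with starting point \<open>x0\<close> and index choices \<open>i\<close>. The iterates form a possibly
  terminating sequence: \<open>x k = Some y\<close> means that the \<open>k\<close>-th iterate is generated and equals
  \<open>y\<close>, and \<open>x k = None\<close> means that the algorithm stopped before generating a \<open>k\<close>-th iterate.
  The value \<open>i k\<close> is constrained only if the \<open>k\<close>-th iterate is generated and violates
  some inequality.
\<close>

definition perceptron_run ::
  "nat \<Rightarrow> (nat \<Rightarrow> 'a::real_inner) \<Rightarrow> real \<Rightarrow> 'a \<Rightarrow> (nat \<Rightarrow> nat) \<Rightarrow> (nat \<Rightarrow> 'a option) \<Rightarrow> bool" where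
  "perceptron_run m a \<alpha> x0 i x \<longleftrightarrow>
     x 0 = Some x0 \<and>
     (\<forall>k. case x k of
            None \<Rightarrow> x (Suc k) = None
          | Some y \<Rightarrow>
              if y \<in> solution_cone m a then x (Suc k) = None
              else i k \<in> {1..m} \<and> y \<bullet> a (i k) < 0 \<and> x (Suc k) = Some (y + \<alpha> *\<^sub>R a (i k)))"

end

theory Submission
  imports Defs
begin

text \<open>
  Every positive multiple of \<open>z\<close> lies in the interior of the cone, and far out on that ray there is
  a point \<open>w\<close> with a lot of room: \<open>w \<bullet> a j\<close> exceeds \<open>\<alpha> * (norm (a j))\<^sup>2 / 2\<close> by a fixed
  amount for all \<open>j\<close> at once, because there are finitely many indices. A correction along a violated
  \<open>a j\<close> then brings the iterate closer to \<open>w\<close>: the cross term with \<open>w\<close> outweighs the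
  second-order term \<open>\<alpha>\<^sup>2 * (norm (a j))\<^sup>2\<close>, however large \<open>\<alpha>\<close> is. The squared distance to \<open>w\<close>
  drops by at least \<open>\<alpha>\<close> per step, so an infinite run would make it negative.
  Measuring the distance to \<open>w\<close> replaces the customary comparison of the linear growth of
  \<open>z \<bullet> y\<close> with the square-root growth of \<open>norm y\<close>.
\<close>

text \<open>
  Violation enters only through the sign of the cross term \<open>2 * \<alpha> * (y \<bullet> v)\<close>; the cross term
  \<open>- 2 * \<alpha> * (w \<bullet> v)\<close> absorbs the second-order term, and the \<open>1\<close> in the margin,
  multiplied by \<open>\<alpha>\<close>, is the guaranteed decrease.
\<close>

lemma step_decreases_dist:
  fixes y w v :: "'a::real_inner"
  assumes "\<alpha> > 0" and "y \<bullet> v < 0" and margin: "2 * (w \<bullet> v) \<ge> \<alpha> * (norm v)\<^sup>2 + 1"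
  shows "(norm (y + \<alpha> *\<^sub>R v - w))\<^sup>2 \<le> (norm (y - w))\<^sup>2 - \<alpha>"
proof -
  have "(norm (y + \<alpha> *\<^sub>R v - w))\<^sup>2
      = (norm (y - w))\<^sup>2 + 2 * (\<alpha> * (y \<bullet> v)) - \<alpha> * (2 * (w \<bullet> v)) + \<alpha> * (\<alpha> * (norm v)\<^sup>2)"
    by (simp add: power2_norm_eq_inner inner_add_left inner_add_right inner_diff_left
        inner_diff_right inner_commute algebra_simps)
  moreover have "\<alpha> * (y \<bullet> v) \<le> 0"
    using assms(1,2) by (simp add: mult_nonneg_nonpos)
  moreover have "\<alpha> * (2 * (w \<bullet> v)) \<ge> \<alpha> * (\<alpha> * (norm v)\<^sup>2) + \<alpha>"
    using mult_left_mono[OF margin, of \<alpha>] assms(1) by (simp add: algebra_simps)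
  ultimately show ?thesis by linarith
qed

lemma exists_point_with_margin:
  fixes a :: "'i \<Rightarrow> 'a::real_inner"
  assumes "finite J" and z: "\<And>j. j \<in> J \<Longrightarrow> z \<bullet> a j > 0"
  obtains w where "\<And>j. j \<in> J \<Longrightarrow> w \<bullet> a j \<ge> c j"
proof -
  \<comment> \<open>The ray point \<open>t *\<^sub>R z\<close> has the margin at \<open>j\<close> as soon as \<open>t\<close> is at least the \<open>j\<close>-th
    of these quotients.\<close>
  have "bdd_above ((\<lambda>j. c j / (z \<bullet> a j)) ` J)"
    using \<open>finite J\<close> by simp
  then obtain t where t: "\<And>j. j \<in> J \<Longrightarrow> c j / (z \<bullet> a j) \<le> t"
    by (auto simp: bdd_above_def)
  show ?thesis
    by (rule that[of "t *\<^sub>R z"]) (use t z in \<open>simp add: pos_divide_le_eq\<close>)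
qed

theorem mainTheorem4:
  fixes a :: "nat \<Rightarrow> 'a::{real_inner, complete_space}"
    and m :: nat
    and z x0 :: 'a
    and \<alpha> :: real
    and i :: "nat \<Rightarrow> nat"
    and x :: "nat \<Rightarrow> 'a option"
  assumes "m \<ge> 1"
    and "\<forall>j\<in>{1..m}. z \<bullet> a j > 0"
    and "\<alpha> > 0"
    and "perceptron_run m a \<alpha> x0 i x"
  shows "\<exists>K y. x K = Some y \<and> y \<in> solution_cone m a"
proof (rule ccontr)
  assume not_solved: "\<not> ?thesis"
  obtain w where w: "\<And>j. j \<in> {1..m} \<Longrightarrow> w \<bullet> a j \<ge> (\<alpha> * (norm (a j))\<^sup>2 + 1) / 2"
    using exists_point_with_margin[of "{1..m}" z a "\<lambda>j. (\<alpha> * (norm (a j))\<^sup>2 + 1) / 2"] assms(2)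
    by auto
  have bound: "\<exists>y. x k = Some y \<and> (norm (y - w))\<^sup>2 \<le> (norm (x0 - w))\<^sup>2 - real k * \<alpha>" for k
  proof (induction k)
    case 0
    show ?case using assms(4) by (simp add: perceptron_run_def)
  next
    case (Suc k)
    then obtain y where y: "x k = Some y"
      and le: "(norm (y - w))\<^sup>2 \<le> (norm (x0 - w))\<^sup>2 - real k * \<alpha>" by blast
    have "y \<notin> solution_cone m a" using not_solved y by blast
    moreover have "case x k of None \<Rightarrow> x (Suc k) = None
        | Some y \<Rightarrow> if y \<in> solution_cone m a then x (Suc k) = None
            else i k \<in> {1..m} \<and> y \<bullet> a (i k) < 0 \<and> x (Suc k) = Some (y + \<alpha> *\<^sub>R a (i k))"
      using assms(4) unfolding perceptron_run_def by blast
    ultimately have step: "i k \<in> {1..m}" "y \<bullet> a (i k) < 0"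
        "x (Suc k) = Some (y + \<alpha> *\<^sub>R a (i k))"
      using y by simp_all
    have "2 * (w \<bullet> a (i k)) \<ge> \<alpha> * (norm (a (i k)))\<^sup>2 + 1"
      using w[OF step(1)] by simp
    from step_decreases_dist[OF assms(3) step(2) this] le step(3) show ?case
      by (simp add: algebra_simps)
  qed
  obtain k :: nat where "(norm (x0 - w))\<^sup>2 < real k * \<alpha>"
    using reals_Archimedean3[OF assms(3)] by blast
  moreover obtain y where "(norm (y - w))\<^sup>2 \<le> (norm (x0 - w))\<^sup>2 - real k * \<alpha>"
    using bound by blast
  ultimately show False
    using zero_le_power2[of "norm (y - w)"] by linarith
qed

end
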